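(* Let $n\geq 0$ be fixed, $0\leq k\leq n$ and $s\geq k+1$. Then for all $q\in\mathbb{H}$, $$\overline{\mathcal{D}}^{\,k+1}\big(\mathcal{M}_{k,s}(q,\overline{q})\big)=\sum_{j=1}^{k+1}2^j\binom{k+1}{j}\frac{k!\,s!}{(j-1)!\,(s-j)!}\,\mathcal{M}_{j-1,s-j}(q,\overline{q}).$$
   Context: $\mathbb{H}$ is the algebra of real quaternions $q=x_0+x_1i+x_2j+x_3k$ with conjugate $\overline q$. $\overline{\mathcal{D}}=\partial_{x_0}-i\partial_{x_1}-j\partial_{x_2}-k\partial_{x_3}$, acting from the left. For integers $s\ge0$, $Q_s(q,\overline q)=\sum_{j=0}^s\frac{2(s-j+1)}{(s+1)(s+2)}q^{s-j}\overline q^{\,j}$. The generalized Appell polyanalytic polynomials are $\mathcal{M}_{k,s}(q,\overline q)=x_0^k\,Q_s(q,\overline q)$ for $k,s\ge 0$. *)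

theory Defs
  imports "HOL-Analysis.Analysis"
begin

text \<open>\<open>Quat x0 x1 x2 x3\<close> is the quaternion $x_0 + x_1 i + x_2 j + x_3 k$.\<close>

datatype quat = Quat (qx0: real) (qx1: real) (qx2: real) (qx3: real)

lemma quat_eq_iff: "p = q \<longleftrightarrow> qx0 p = qx0 q \<and> qx1 p = qx1 q \<and> qx2 p = qx2 q \<and> qx3 p = qx3 q"
  by (auto intro: quat.expand)

instantiation quat :: real_algebra_1
begin

definition "0 = Quat 0 0 0 0"
definition "1 = Quat 1 0 0 0"
definition "p + q = Quat (qx0 p + qx0 q) (qx1 p + qx1 q) (qx2 p + qx2 q) (qx3 p + qx3 q)"
definition "p - q = Quat (qx0 p - qx0 q) (qx1 p - qx1 q) (qx2 p - qx2 q) (qx3 p - qx3 q)"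
definition "- q = Quat (- qx0 q) (- qx1 q) (- qx2 q) (- qx3 q)"
definition "r *\<^sub>R q = Quat (r * qx0 q) (r * qx1 q) (r * qx2 q) (r * qx3 q)"
definition "p * q = Quat
  (qx0 p * qx0 q - qx1 p * qx1 q - qx2 p * qx2 q - qx3 p * qx3 q)
  (qx0 p * qx1 q + qx1 p * qx0 q + qx2 p * qx3 q - qx3 p * qx2 q)
  (qx0 p * qx2 q - qx1 p * qx3 q + qx2 p * qx0 q + qx3 p * qx1 q)
  (qx0 p * qx3 q + qx1 p * qx2 q - qx2 p * qx1 q + qx3 p * qx0 q)"

lemmas quat_arith_defs = zero_quat_def one_quat_def plus_quat_def minus_quat_def
  uminus_quat_def scaleR_quat_def times_quat_def

instance
  by standard (simp_all add: quat_arith_defs algebra_simps)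

end

instantiation quat :: real_inner
begin

definition "inner p q = qx0 p * qx0 q + qx1 p * qx1 q + qx2 p * qx2 q + qx3 p * qx3 q"
definition "norm (q::quat) = sqrt (inner q q)"
definition "sgn (q::quat) = q /\<^sub>R norm q"
definition "dist (p::quat) q = norm (p - q)"
definition [code del]:
  "(uniformity :: (quat \<times> quat) filter) = (INF e\<in>{0<..}. principal {(x, y). dist x y < e})"
definition [code del]:
  "open (U :: quat set) \<longleftrightarrow> (\<forall>x\<in>U. eventually (\<lambda>(x', y). x' = x \<longrightarrow> y \<in> U) uniformity)"

instance
proof
  fix p q r :: quat and a :: real
  show "inner p q = inner q p"
    by (simp add: inner_quat_def algebra_simps)
  show "inner (p + q) r = inner p r + inner q r"
    by (simp add: inner_quat_def plus_quat_def algebra_simps)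
  show "inner (a *\<^sub>R p) q = a * inner p q"
    by (simp add: inner_quat_def scaleR_quat_def algebra_simps)
  show "0 \<le> inner p p"
    by (simp add: inner_quat_def)
  show "(inner p p = 0) = (p = 0)"
    by (simp add: inner_quat_def zero_quat_def quat_eq_iff add_nonneg_eq_0_iff)
qed (simp_all add: norm_quat_def sgn_quat_def dist_quat_def uniformity_quat_def open_quat_def)

end

instance quat :: real_normed_algebra_1
proof
  fix p q :: quat
  have "inner (p * q) (p * q) = inner p p * inner q q"
    by (simp add: inner_quat_def times_quat_def algebra_simps)
  then show "norm (p * q) \<le> norm p * norm q"
    by (simp add: norm_quat_def real_sqrt_mult)
  show "norm (1::quat) = 1"
    by (simp add: norm_quat_def inner_quat_def one_quat_def)
qed

definition quat_i :: quat where "quat_i = Quat 0 1 0 0"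
definition quat_j :: quat where "quat_j = Quat 0 0 1 0"
definition quat_k :: quat where "quat_k = Quat 0 0 0 1"

definition qconj :: "quat \<Rightarrow> quat" where
  "qconj q = Quat (qx0 q) (- qx1 q) (- qx2 q) (- qx3 q)"

text \<open>The partial derivatives with respect to \<open>x0, x1, x2, x3\<close> are the directional
  derivatives along \<open>1, quat_i, quat_j, quat_k\<close>.\<close>

definition qpartial :: "quat \<Rightarrow> (quat \<Rightarrow> quat) \<Rightarrow> quat \<Rightarrow> quat" where
  "qpartial e f q = vector_derivative (\<lambda>t::real. f (q + t *\<^sub>R e)) (at 0)"

definition Dbar :: "(quat \<Rightarrow> quat) \<Rightarrow> quat \<Rightarrow> quat" where
  "Dbar f q = qpartial 1 f q - quat_i * qpartial quat_i f q
     - quat_j * qpartial quat_j f q - quat_k * qpartial quat_k f q"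

definition appell_Q :: "nat \<Rightarrow> quat \<Rightarrow> quat" where
  "appell_Q s q = (\<Sum>j=0..s. (2 * real (s - j + 1) / (real (s + 1) * real (s + 2)))
     *\<^sub>R (q ^ (s - j) * qconj q ^ j))"

definition appell_M :: "nat \<Rightarrow> nat \<Rightarrow> quat \<Rightarrow> quat" where
  "appell_M k s q = (qx0 q ^ k) *\<^sub>R appell_Q s q"

end

theory Submission
  imports Defs
begin

text \<open>
  The real-valued functions \<open>x0\<close> and \<open>\<bar>q\<bar>\<^sup>2\<close> commute with everything, so the left operator \<open>Dbar\<close>
  satisfies a product rule against them, and \<open>q + qconj q = 2 x0\<close>, \<open>qconj q * q = \<bar>q\<bar>\<^sup>2\<close>. Hence the
  powers of \<open>q\<close> and the unnormalised sums behind \<open>Q\<^sub>s\<close> satisfy linear recurrences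
  whose coefficients are these functions, and differentiating the recurrences gives the Appell
  property \<open>Dbar Q\<^sub>s = 2 s Q\<^sub>s\<^sub>-\<^sub>1\<close> by induction. Consequently \<open>Dbar\<close> acts on \<open>x0\<^sup>k Q\<^sub>s\<close>
  as a sum of two commuting lowering operators, and its powers are given by the binomial theorem.
  For the power \<open>k + 1\<close> the term that only lowers \<open>k\<close> vanishes.
\<close>

section \<open>Calculus of the conjugate Fueter operator\<close>

definition dbar_symbol :: "(quat \<Rightarrow> quat) \<Rightarrow> quat" where
  "dbar_symbol L = L 1 - quat_i * L quat_i - quat_j * L quat_j - quat_k * L quat_k"

text \<open>\<open>vector_derivative\<close> has an arbitrary value where no derivative exists, so
  differentiability is carried along with the value; the rules below then compose.\<close>

definition has_Dbar :: "(quat \<Rightarrow> quat) \<Rightarrow> quat \<Rightarrow> quat \<Rightarrow> bool" where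
  "has_Dbar f d q \<longleftrightarrow> (\<exists>L. (f has_derivative L) (at q) \<and> d = dbar_symbol L)"

lemma qpartial_has_derivative:
  assumes "(f has_derivative L) (at q)"
  shows "qpartial e f q = L e"
proof -
  have f: "(f has_derivative L) (at ((\<lambda>t::real. q + t *\<^sub>R e) 0))"
    using assms by simp
  have "((\<lambda>t::real. q + t *\<^sub>R e) has_derivative (\<lambda>t. t *\<^sub>R e)) (at 0)"
    by (auto intro!: derivative_eq_intros)
  then have "(f \<circ> (\<lambda>t::real. q + t *\<^sub>R e) has_derivative L \<circ> (\<lambda>t. t *\<^sub>R e)) (at 0)"
    using f by (rule diff_chain_at)
  moreover have "L (t *\<^sub>R e) = t *\<^sub>R L e" for t
    using has_derivative_bounded_linear[OF assms] by (simp add: bounded_linear.linear linear_scale)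
  ultimately have "((\<lambda>t. f (q + t *\<^sub>R e)) has_vector_derivative L e) (at 0)"
    by (simp add: has_vector_derivative_def o_def)
  then show ?thesis
    by (simp add: qpartial_def vector_derivative_at)
qed

lemma Dbar_eq: "has_Dbar f d q \<Longrightarrow> Dbar f q = d"
  by (auto simp: has_Dbar_def Dbar_def dbar_symbol_def qpartial_has_derivative)

lemma has_Dbar_const: "has_Dbar (\<lambda>q. c) 0 q"
  unfolding has_Dbar_def by (intro exI[of _ "\<lambda>h. 0"]) (simp add: dbar_symbol_def)

lemma has_Dbar_id: "has_Dbar (\<lambda>q. q) 4 q"
  unfolding has_Dbar_def
proof (intro exI conjI)
  show "((\<lambda>q. q) has_derivative (\<lambda>h. h)) (at q)" by simp
  \<comment> \<open>As a real multiple of 1, the value 4 = 1 - i^2 - j^2 - k^2 can be checked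
    componentwise.\<close>
  have "(4::quat) = 4 *\<^sub>R 1" by (metis scaleR_conv_of_real mult.right_neutral of_real_numeral)
  then show "4 = dbar_symbol (\<lambda>h. h)"
    by (simp add: dbar_symbol_def quat_i_def quat_j_def quat_k_def quat_arith_defs)
qed

lemma has_Dbar_add:
  assumes "has_Dbar f d q" "has_Dbar g e q"
  shows "has_Dbar (\<lambda>q. f q + g q) (d + e) q"
proof -
  obtain K L where "(f has_derivative K) (at q)" and d: "d = dbar_symbol K"
    and "(g has_derivative L) (at q)" and e: "e = dbar_symbol L"
    using assms by (auto simp: has_Dbar_def)
  then have "((\<lambda>q. f q + g q) has_derivative (\<lambda>h. K h + L h)) (at q)"
    by (intro derivative_intros)
  moreover have "d + e = dbar_symbol (\<lambda>h. K h + L h)"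
    unfolding d e dbar_symbol_def by (simp add: algebra_simps)
  ultimately show ?thesis
    by (auto simp: has_Dbar_def)
qed

text \<open>Real values commute with the units, so the product rule survives the left action; the
  \<open>Quat\<close> factor is the operator applied to \<open>u\<close> itself.\<close>

lemma has_Dbar_mult_real:
  assumes "(u has_derivative U) (at q)" and "has_Dbar f d q"
  shows "has_Dbar (\<lambda>q. u q *\<^sub>R f q) (Quat (U 1) (- U quat_i) (- U quat_j) (- U quat_k) * f q + u q *\<^sub>R d) q"
proof -
  obtain L where L: "(f has_derivative L) (at q)" and d: "d = dbar_symbol L"
    using assms(2) by (auto simp: has_Dbar_def)
  have U: "Quat (U 1) (- U quat_i) (- U quat_j) (- U quat_k)
    = U 1 *\<^sub>R 1 - U quat_i *\<^sub>R quat_i - U quat_j *\<^sub>R quat_j - U quat_k *\<^sub>R quat_k"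
    by (simp add: quat_i_def quat_j_def quat_k_def quat_arith_defs)
  have "((\<lambda>q. u q *\<^sub>R f q) has_derivative (\<lambda>h. u q *\<^sub>R L h + U h *\<^sub>R f q)) (at q)"
    using assms(1) L by (rule has_derivative_scaleR)
  moreover have "Quat (U 1) (- U quat_i) (- U quat_j) (- U quat_k) * f q + u q *\<^sub>R d
    = dbar_symbol (\<lambda>h. u q *\<^sub>R L h + U h *\<^sub>R f q)"
    unfolding U d dbar_symbol_def by (simp add: algebra_simps)
  ultimately show ?thesis
    by (auto simp: has_Dbar_def)
qed

lemma has_Dbar_scaleR: "has_Dbar f d q \<Longrightarrow> has_Dbar (\<lambda>q. c *\<^sub>R f q) (c *\<^sub>R d) q"
  using has_Dbar_mult_real[OF has_derivative_const, of f d q c]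
  by (simp add: zero_quat_def[symmetric])

lemma has_Dbar_diff:
  "has_Dbar f d q \<Longrightarrow> has_Dbar g e q \<Longrightarrow> has_Dbar (\<lambda>q. f q - g q) (d - e) q"
  using has_Dbar_add[of f d q "\<lambda>q. - 1 *\<^sub>R g q" "- 1 *\<^sub>R e"] has_Dbar_scaleR[of g e q "- 1"]
  by simp

lemma has_Dbar_sum:
  "(\<And>i. i \<in> I \<Longrightarrow> has_Dbar (f i) (d i) q) \<Longrightarrow> has_Dbar (\<lambda>q. \<Sum>i\<in>I. f i q) (\<Sum>i\<in>I. d i) q"
  by (induction I rule: infinite_finite_induct) (auto intro: has_Dbar_const has_Dbar_add)

lemma qx0_has_derivative: "(qx0 has_derivative qx0) (at q)"
proof -
  have "qx0 = (\<lambda>q. inner q 1)"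
    by (simp add: inner_quat_def one_quat_def)
  then show ?thesis
    by (metis bounded_linear_imp_has_derivative bounded_linear_inner_left)
qed

lemma has_Dbar_qx0_power:
  assumes "has_Dbar f d q"
  shows "has_Dbar (\<lambda>q. qx0 q ^ k *\<^sub>R f q) (real k *\<^sub>R (qx0 q ^ (k - 1) *\<^sub>R f q) + qx0 q ^ k *\<^sub>R d) q"
proof -
  have A: "((\<lambda>q. qx0 q ^ k) has_derivative (\<lambda>h. real k * qx0 h * qx0 q ^ (k - 1))) (at q)"
    using qx0_has_derivative by (auto intro!: derivative_eq_intros)
  have B: "Quat (real k * qx0 1 * c) (- (real k * qx0 quat_i * c)) (- (real k * qx0 quat_j * c))
      (- (real k * qx0 quat_k * c)) * x = real k *\<^sub>R (c *\<^sub>R x)" for c x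
    by (simp add: quat_arith_defs quat_i_def quat_j_def quat_k_def)
  show ?thesis
    using has_Dbar_mult_real[OF A assms] unfolding B .
qed

lemma has_Dbar_double_qx0:
  "has_Dbar f d q \<Longrightarrow>
    has_Dbar (\<lambda>q. (2 * qx0 q) *\<^sub>R f q) (2 *\<^sub>R f q + (2 * qx0 q) *\<^sub>R d) q"
  using has_Dbar_scaleR[OF has_Dbar_qx0_power[of f d q 1], of 2]
  by (simp add: algebra_simps)

text \<open>The operator sends |q|^2 to twice the conjugate of q.\<close>

lemma has_Dbar_inner_self:
  assumes "has_Dbar f d q"
  shows "has_Dbar (\<lambda>q. inner q q *\<^sub>R f q) (2 *\<^sub>R (qconj q * f q) + inner q q *\<^sub>R d) q"
proof -
  have A: "((\<lambda>q. inner q q) has_derivative (\<lambda>h. 2 * inner q h)) (at q)"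
    by (auto intro!: derivative_eq_intros simp: inner_commute)
  have B: "Quat (2 * inner q 1) (- (2 * inner q quat_i)) (- (2 * inner q quat_j))
      (- (2 * inner q quat_k)) = 2 *\<^sub>R qconj q"
    by (simp add: inner_quat_def qconj_def quat_arith_defs quat_i_def quat_j_def quat_k_def)
  show ?thesis
    using has_Dbar_mult_real[OF A assms] unfolding B mult_scaleR_left .
qed


section \<open>The Appell property\<close>

lemma qconj_add: "q + qconj q = (2 * qx0 q) *\<^sub>R 1"
  by (simp add: qconj_def quat_arith_defs)

lemma qconj_mult_self: "qconj q * q = inner q q *\<^sub>R 1"
  by (simp add: qconj_def inner_quat_def quat_arith_defs)

lemma qconj_commute: "q * qconj q = qconj q * q"
  by (simp add: qconj_def quat_arith_defs)

lemma double_qx0_scaleR: "(2 * qx0 q) *\<^sub>R u = q * u + qconj q * u"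
  by (metis qconj_add distrib_right mult_scaleR_left mult_1)

lemma inner_self_scaleR: "inner q q *\<^sub>R u = qconj q * (q * u)"
  by (metis qconj_mult_self mult.assoc mult_scaleR_left mult_1)

text \<open>Indices are shifted by one, so that both sums are \<open>0\<close> at \<open>n = 0\<close> and the
  recurrences need no separate initial case.\<close>

definition hsum :: "nat \<Rightarrow> quat \<Rightarrow> quat" where
  "hsum n q = (\<Sum>j<n. q ^ (n - 1 - j) * qconj q ^ j)"

definition wsum :: "nat \<Rightarrow> quat \<Rightarrow> quat" where
  "wsum n q = (\<Sum>j<n. real (n - j) *\<^sub>R (q ^ (n - 1 - j) * qconj q ^ j))"

text \<open>For \<open>j < n\<close> the exponent \<open>n - j\<close> is positive, so a left factor
  \<open>q\<close> splits off.\<close>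

lemma sum_hom_Suc:
  "(\<Sum>j<n. c j *\<^sub>R (q ^ (n - j) * qconj q ^ j)) = q * (\<Sum>j<n. c j *\<^sub>R (q ^ (n - 1 - j) * qconj q ^ j))"
proof -
  have "q ^ (n - j) = q * q ^ (n - 1 - j)" if "j < n" for j
    using that by (metis Suc_diff_Suc diff_Suc_eq_diff_pred power_Suc)
  then show ?thesis
    by (simp add: sum_distrib_left mult.assoc)
qed

lemma hsum_0: "hsum 0 q = 0"
  by (simp add: hsum_def)

lemma wsum_0: "wsum 0 q = 0"
  by (simp add: wsum_def)

lemma hsum_Suc: "hsum (Suc n) q = q * hsum n q + qconj q ^ n"
  using sum_hom_Suc[of "\<lambda>_. 1" q n] by (simp add: hsum_def)

text \<open>Here the term \<open>j = 0\<close> is split off instead of the last one;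
  \<open>qconj q\<close> moves to the front because it commutes with powers of
  \<open>q\<close>.\<close>

lemma hsum_Suc': "hsum (Suc n) q = q ^ n + qconj q * hsum n q"
proof -
  have "q ^ m * (qconj q * x) = qconj q * (q ^ m * x)" for m x
    using power_commuting_commutes[OF qconj_commute, of q m] by (metis mult.assoc)
  then show ?thesis
    unfolding hsum_def by (subst sum.lessThan_Suc_shift) (simp add: sum_distrib_left)
qed

lemma wsum_Suc: "wsum (Suc n) q = q * wsum n q + hsum (Suc n) q"
proof -
  \<comment> \<open>The weight splits as \<open>Suc n - j = (n - j) + 1\<close>, and
    \<open>n - j\<close> vanishes at the last index \<open>j = n\<close>.\<close>
  have "wsum (Suc n) q = (\<Sum>j<Suc n. real (n - j) *\<^sub>R (q ^ (n - j) * qconj q ^ j)) + hsum (Suc n) q"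
    unfolding wsum_def hsum_def sum.distrib[symmetric]
    by (intro sum.cong) (auto simp: Suc_diff_le algebra_simps)
  also have "(\<Sum>j<Suc n. real (n - j) *\<^sub>R (q ^ (n - j) * qconj q ^ j)) = q * wsum n q"
    using sum_hom_Suc[of "\<lambda>j. real (n - j)" q n] by (simp add: wsum_def)
  finally show ?thesis .
qed

text \<open>\<open>hsum\<close> is the complete homogeneous sum in \<open>q\<close> and
  \<open>qconj q\<close>, the two commuting roots of t^2 - 2 x0 t + |q|^2.\<close>

lemma hsum_Suc_Suc:
  "hsum (Suc (Suc n)) q = (2 * qx0 q) *\<^sub>R hsum (Suc n) q - inner q q *\<^sub>R hsum n q"
proof -
  have "qconj q ^ Suc n = qconj q * (hsum (Suc n) q - q * hsum n q)"
    by (simp add: hsum_Suc)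
  then show ?thesis
    unfolding hsum_Suc[of "Suc n"] double_qx0_scaleR inner_self_scaleR by (simp add: algebra_simps)
qed

text \<open>The weights make \<open>q\<close> a double root; the quadratic removes it only once,
  which leaves the inhomogeneous term \<open>q ^ Suc n\<close>.\<close>

lemma wsum_Suc_Suc:
  "wsum (Suc (Suc n)) q = (2 * qx0 q) *\<^sub>R wsum (Suc n) q - inner q q *\<^sub>R wsum n q + q ^ Suc n"
proof -
  have "hsum (Suc (Suc n)) q = q ^ Suc n + qconj q * (wsum (Suc n) q - q * wsum n q)"
    unfolding hsum_Suc'[of "Suc n"] by (simp add: wsum_Suc)
  then show ?thesis
    unfolding wsum_Suc[of "Suc n"] double_qx0_scaleR inner_self_scaleR by (simp add: algebra_simps)
qed

lemma power_Suc_Suc_quat: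
  "q ^ Suc (Suc n) = (2 * qx0 q) *\<^sub>R q ^ Suc n - inner q q *\<^sub>R q ^ n"
  by (simp add: double_qx0_scaleR inner_self_scaleR)

text \<open>Two-step induction along \<open>power_Suc_Suc_quat\<close>. At \<open>n = 0\<close> the
  truncated exponent \<open>n - 1\<close> has coefficient 0.\<close>

lemma has_Dbar_power:
  "has_Dbar (\<lambda>q. q ^ n) (2 *\<^sub>R hsum n q + (2 * real n) *\<^sub>R q ^ (n - 1)) q"
proof (induction n rule: induct_nat_012)
  case 0
  show ?case using has_Dbar_const[of 1] by (simp add: hsum_0)
next
  case 1
  have "(4::quat) = 2 *\<^sub>R 1 + 2 *\<^sub>R 1"
    by (simp add: scaleR_2)
  then show ?case using has_Dbar_id by (simp add: hsum_0 hsum_Suc)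
next
  case (ge2 n)
  have s: "real n *\<^sub>R (inner q q *\<^sub>R q ^ (n - 1)) = real n *\<^sub>R (qconj q * q ^ n)"
    by (cases n) (simp_all add: inner_self_scaleR)
  have "has_Dbar (\<lambda>q. q ^ Suc (Suc n))
     (2 *\<^sub>R q ^ Suc n + (2 * qx0 q) *\<^sub>R (2 *\<^sub>R hsum (Suc n) q + (2 * real (Suc n)) *\<^sub>R q ^ n)
      - (2 *\<^sub>R (qconj q * q ^ n) + inner q q *\<^sub>R (2 *\<^sub>R hsum n q + (2 * real n) *\<^sub>R q ^ (n - 1)))) q"
    unfolding power_Suc_Suc_quat
    using has_Dbar_diff[OF has_Dbar_double_qx0[OF ge2(2)] has_Dbar_inner_self[OF ge2(1)]] by simp
  also have "2 *\<^sub>R q ^ Suc n + (2 * qx0 q) *\<^sub>R (2 *\<^sub>R hsum (Suc n) q + (2 * real (Suc n)) *\<^sub>R q ^ n)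
      - (2 *\<^sub>R (qconj q * q ^ n) + inner q q *\<^sub>R (2 *\<^sub>R hsum n q + (2 * real n) *\<^sub>R q ^ (n - 1)))
    = 2 *\<^sub>R hsum (Suc (Suc n)) q + 2 *\<^sub>R q ^ Suc n + (2 * real (Suc n)) *\<^sub>R ((2 * qx0 q) *\<^sub>R q ^ n)
      - 2 *\<^sub>R (qconj q * q ^ n) - 2 *\<^sub>R (real n *\<^sub>R (inner q q *\<^sub>R q ^ (n - 1)))"
    unfolding hsum_Suc_Suc by (simp add: scaleR_diff_right scaleR_add_right mult_ac)
  \<comment> \<open>The terms in \<open>qconj q * q ^ n\<close> cancel, as 2(n+1) - 2 - 2n = 0;
    \<open>q ^ Suc n\<close> collects 2 + 2(n+1).\<close>
  also have "\<dots> = 2 *\<^sub>R hsum (Suc (Suc n)) q + (2 * real (Suc (Suc n))) *\<^sub>R q ^ (Suc (Suc n) - 1)"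
    unfolding s double_qx0_scaleR using scaleR_add_left[of 2 2 "q * q ^ n"]
    by (simp add: scaleR_add_left scaleR_add_right distrib_left mult_ac)
  finally show ?case .
qed

lemma has_Dbar_wsum:
  "has_Dbar (wsum n) ((2 * real (n + 1)) *\<^sub>R wsum (n - 1) q) q"
proof (induction n rule: induct_nat_012)
  case 0
  have "wsum 0 = (\<lambda>q. 0)" by (simp add: wsum_0 fun_eq_iff)
  then show ?case using has_Dbar_const by (simp add: wsum_0)
next
  case 1
  have "wsum (Suc 0) = (\<lambda>q. 1)" by (simp add: wsum_def fun_eq_iff)
  then show ?case using has_Dbar_const by (simp add: wsum_0)
next
  case (ge2 n)
  have "has_Dbar (wsum (Suc (Suc n)))
     (2 *\<^sub>R wsum (Suc n) q + (2 * qx0 q) *\<^sub>R ((2 * real (n + 2)) *\<^sub>R wsum n q)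
      - (2 *\<^sub>R (qconj q * wsum n q) + inner q q *\<^sub>R ((2 * real (n + 1)) *\<^sub>R wsum (n - 1) q))
      + (2 *\<^sub>R hsum (Suc n) q + (2 * real (Suc n)) *\<^sub>R q ^ n)) q" (is "has_Dbar _ ?d q")
    unfolding wsum_Suc_Suc[abs_def]
    using has_Dbar_add[OF has_Dbar_diff[OF has_Dbar_double_qx0[OF ge2(2)] has_Dbar_inner_self[OF ge2(1)]]
        has_Dbar_power[of "Suc n"]] by simp
  also have "?d = (2 * real (n + 3)) *\<^sub>R wsum (Suc n) q"
  proof -
    \<comment> \<open>The recurrence one index lower; at \<open>n = 0\<close> it still holds,
      reading 1 = 0 - 0 + 1.\<close>
    have w: "wsum (Suc n) q = (2 * qx0 q) *\<^sub>R wsum n q - inner q q *\<^sub>R wsum (n - 1) q + q ^ n"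
      by (cases n) (simp_all add: wsum_Suc_Suc wsum_0, simp add: wsum_def)
    \<comment> \<open>Grouped so that each of the three brackets equals
      \<open>wsum (Suc n) q\<close>; the coefficients add up to 2 + 2(n+1) + 2 = 2(n+3).\<close>
    have "?d = 2 *\<^sub>R wsum (Suc n) q
        + (2 * real (n + 1)) *\<^sub>R ((2 * qx0 q) *\<^sub>R wsum n q - inner q q *\<^sub>R wsum (n - 1) q + q ^ n)
        + 2 *\<^sub>R ((2 * qx0 q) *\<^sub>R wsum n q - qconj q * wsum n q + hsum (Suc n) q)"
      using scaleR_add_left[of "qx0 q * 4" "qx0 q * 4" "wsum n q"] by (simp add: algebra_simps)
    also have "(2 * qx0 q) *\<^sub>R wsum n q - qconj q * wsum n q + hsum (Suc n) q = wsum (Suc n) q"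
      by (simp add: double_qx0_scaleR wsum_Suc)
    finally show ?thesis
      unfolding w[symmetric] scaleR_add_left[symmetric] by simp
  qed
  finally show ?case by (simp add: eval_nat_numeral)
qed

lemma appell_Q_eq_wsum: "appell_Q s q = (2 / (real (s + 1) * real (s + 2))) *\<^sub>R wsum (s + 1) q"
  unfolding appell_Q_def wsum_def scaleR_sum_right
  by (intro sum.cong) (auto simp: Suc_diff_le)

lemma has_Dbar_appell_Q: "has_Dbar (appell_Q s) ((2 * real s) *\<^sub>R appell_Q (s - 1) q) q"
proof -
  have "has_Dbar (wsum (s + 1)) ((2 * real (s + 2)) *\<^sub>R wsum s q) q"
    using has_Dbar_wsum[of "s + 1"] by simp
  then have "has_Dbar (appell_Q s)
      ((2 / (real (s + 1) * real (s + 2))) *\<^sub>R ((2 * real (s + 2)) *\<^sub>R wsum s q)) q"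
    unfolding appell_Q_eq_wsum[abs_def]
    by (rule has_Dbar_scaleR)
  also have "(2 / (real (s + 1) * real (s + 2))) *\<^sub>R ((2 * real (s + 2)) *\<^sub>R wsum s q)
      = (2 * real s) *\<^sub>R appell_Q (s - 1) q"
  \<comment> \<open>At \<open>s = 0\<close> both sides vanish; otherwise the normalising constants
    of degrees \<open>s\<close> and \<open>s - 1\<close> are compared.\<close>
  proof (cases s)
    case (Suc m)
    have "2 / (real (s + 1) * real (s + 2)) * (2 * real (s + 2)) = 2 * real s * (2 / (real s * real (s + 1)))"
    proof -
      have "2 / ((x + 1) * (x + 2)) * (2 * (x + 2)) = 2 * x * (2 / (x * (x + 1)))" if "x > 0" for x :: real
        using that by (simp add: divide_simps)
      from this[of "real s"] Suc show ?thesis by (simp add: add_ac)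
    qed
    with Suc show ?thesis
      by (simp add: appell_Q_eq_wsum add.commute)
  qed (simp add: wsum_0)
  finally show ?thesis .
qed

lemma has_Dbar_appell_M:
  "has_Dbar (appell_M k s)
    (real k *\<^sub>R appell_M (k - 1) s q + (2 * real s) *\<^sub>R appell_M k (s - 1) q) q"
  using has_Dbar_qx0_power[OF has_Dbar_appell_Q, of k s q]
  unfolding appell_M_def[abs_def] by (simp add: mult_ac)


section \<open>Powers of the operator\<close>

text \<open>\<open>g a b\<close> is the result of \<open>a\<close> lowerings of one kind and
  \<open>b\<close> of the other, in any order. An equality of functions is proved so that
  \<open>Dbar\<close> can be applied to the induction hypothesis.\<close>

lemma Dbar_funpow_Leibniz:
  assumes g: "\<And>a b q. has_Dbar (g a b) (g (Suc a) b q + g a (Suc b) q) q"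
  shows "(Dbar ^^ m) (g 0 0) = (\<lambda>q. \<Sum>i\<le>m. real (m choose i) *\<^sub>R g (m - i) i q)"
proof (induction m)
  case 0
  show ?case by simp
next
  case (Suc m)
  show ?case
  proof
    fix q
    let ?B = "\<lambda>i. g (Suc m - i) i q"
    have "(Dbar ^^ Suc m) (g 0 0) q
        = (\<Sum>i\<le>m. real (m choose i) *\<^sub>R (g (Suc (m - i)) i q + g (m - i) (Suc i) q))"
      by (simp add: Suc Dbar_eq[OF has_Dbar_sum[OF has_Dbar_scaleR[OF g]]])
    also have "\<dots> = (\<Sum>i\<le>m. real (m choose i) *\<^sub>R ?B i) + (\<Sum>i\<le>m. real (m choose i) *\<^sub>R ?B (Suc i))"
      by (simp add: scaleR_add_right sum.distrib Suc_diff_le)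
    \<comment> \<open>Adding the zero term \<open>i = Suc m\<close> makes the index shift possible;
      Pascal's rule then merges the two sums.\<close>
    also have "(\<Sum>i\<le>m. real (m choose i) *\<^sub>R ?B i)
        = ?B 0 + (\<Sum>i\<le>m. real (m choose Suc i) *\<^sub>R ?B (Suc i))"
      using sum.atMost_Suc_shift[of "\<lambda>i. real (m choose i) *\<^sub>R ?B i" m] by (simp add: binomial_eq_0)
    also have "?B 0 + (\<Sum>i\<le>m. real (m choose Suc i) *\<^sub>R ?B (Suc i)) + (\<Sum>i\<le>m. real (m choose i) *\<^sub>R ?B (Suc i))
        = (\<Sum>i\<le>Suc m. real (Suc m choose i) *\<^sub>R ?B i)"
      by (simp add: sum.atMost_Suc_shift sum.distrib[symmetric] scaleR_add_left add_ac del: sum.atMost_Suc)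
    finally show "(Dbar ^^ Suc m) (g 0 0) q = (\<Sum>i\<le>Suc m. real (Suc m choose i) *\<^sub>R ?B i)" .
  qed
qed

text \<open>\<open>fact a * (k choose a)\<close> is the falling factorial; it is \<open>0\<close> exactly when the
  subtraction \<open>k - a\<close> would be truncated.\<close>

lemma falling_Suc: "fact (Suc a) * real (k choose Suc a) = fact a * real (k choose a) * real (k - a)"
proof -
  have "Suc a * (k choose Suc a) = (k choose a) * (k - a)"
    by (metis binomial_absorb_comp binomial_absorption mult.commute)
  then have "real (Suc a) * real (k choose Suc a) = real (k choose a) * real (k - a)"
    by (metis of_nat_mult)
  then show ?thesis
    by (simp only: fact_Suc) (simp add: mult_ac)
qed

lemma falling_fact: "a \<le> k \<Longrightarrow> fact a * real (k choose a) = fact k / fact (k - a)"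
  by (simp add: binomial_fact)

lemma Dbar_funpow_appell_M:
  "(Dbar ^^ m) (appell_M k s) q = (\<Sum>i\<le>m. (real (m choose i) * (fact (m - i) * real (k choose (m - i)))
      * (2 ^ i * (fact i * real (s choose i)))) *\<^sub>R appell_M (k - (m - i)) (s - i) q)"
proof -
  \<comment> \<open>The coefficient accumulates the factors k, k-1, ... and 2s, 2(s-1), ... produced
    by the successive lowerings.\<close>
  define g where "g a b q = ((fact a * real (k choose a)) * (2 ^ b * (fact b * real (s choose b))))
      *\<^sub>R appell_M (k - a) (s - b) q" for a b q
  have "has_Dbar (g a b) (g (Suc a) b q + g a (Suc b) q) q" for a b q
  proof -
    let ?c = "(fact a * real (k choose a)) * (2 ^ b * (fact b * real (s choose b)))"
    have "has_Dbar (g a b) (?c *\<^sub>R (real (k - a) *\<^sub>R appell_M (k - a - 1) (s - b) q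
        + (2 * real (s - b)) *\<^sub>R appell_M (k - a) (s - b - 1) q)) q"
      unfolding g_def[abs_def] by (rule has_Dbar_scaleR[OF has_Dbar_appell_M])
    also have "?c *\<^sub>R (real (k - a) *\<^sub>R appell_M (k - a - 1) (s - b) q
        + (2 * real (s - b)) *\<^sub>R appell_M (k - a) (s - b - 1) q) = g (Suc a) b q + g a (Suc b) q"
      unfolding g_def falling_Suc by (simp add: scaleR_add_right mult_ac)
    finally show ?thesis .
  qed
  from Dbar_funpow_Leibniz[of g, OF this] have
    "(Dbar ^^ m) (g 0 0) q = (\<Sum>i\<le>m. real (m choose i) *\<^sub>R g (m - i) i q)"
    by simp
  moreover have "g 0 0 = appell_M k s"
    by (simp add: g_def fun_eq_iff)
  ultimately show ?thesis
    by (simp add: g_def mult.assoc)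
qed

theorem theorem3p5:
  fixes n k s :: nat and q :: quat
  assumes "0 \<le> n" and "0 \<le> k" and "k \<le> n" and "s \<ge> k + 1"
  shows "(Dbar ^^ (k + 1)) (appell_M k s) q =
    (\<Sum>j=1..k+1. (2 ^ j * real ((k + 1) choose j) * (fact k * fact s / (fact (j - 1) * fact (s - j))))
       *\<^sub>R appell_M (j - 1) (s - j) q)"
proof -
  let ?f = "\<lambda>i. (real (k + 1 choose i) * (fact (k + 1 - i) * real (k choose (k + 1 - i)))
    * (2 ^ i * (fact i * real (s choose i)))) *\<^sub>R appell_M (k - (k + 1 - i)) (s - i) q"
  have "(Dbar ^^ (k + 1)) (appell_M k s) q = sum ?f {..k + 1}"
    by (rule Dbar_funpow_appell_M)
  \<comment> \<open>The term \<open>i = 0\<close> would lower \<open>k\<close> a total of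
    \<open>k + 1\<close> times, and \<open>k choose (k + 1)\<close> is 0.\<close>
  also have "\<dots> = sum ?f {1..k + 1}"
    by (rule sum.mono_neutral_right) (auto simp: Suc_le_eq binomial_eq_0)
  also have "\<dots> = (\<Sum>j=1..k+1. (2 ^ j * real ((k + 1) choose j)
      * (fact k * fact s / (fact (j - 1) * fact (s - j)))) *\<^sub>R appell_M (j - 1) (s - j) q)"
  proof (rule sum.cong)
    fix j assume "j \<in> {1..k + 1}"
    \<comment> \<open>These bounds turn both falling factorials into quotients, k!/(j-1)! and
      s!/(s-j)!; \<open>j \<le> s\<close> comes from \<open>s \<ge> k + 1\<close>.\<close>
    then have "k - (k + 1 - j) = j - 1" "k + 1 - j \<le> k" "j \<le> s"
      using assms(4) by auto
    then show "?f j = (2 ^ j * real ((k + 1) choose j)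
        * (fact k * fact s / (fact (j - 1) * fact (s - j)))) *\<^sub>R appell_M (j - 1) (s - j) q"
      by (simp add: falling_fact mult_ac)
  qed simp
  finally show ?thesis .
qed

end
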